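(* Let $\delta\in(0,1)$, and let $X$ be a real random variable with finite second moment and $P(X\neq0)=\epsilon$. If $M_1(\epsilon)<\delta$, then for every $\sigma_w>0$ the (stable) fixed point $\sigma_\ell$ of $\Psi_{\lambda_*,1}(\sigma^2)$ is unique, and it satisfies $$\lim_{\sigma_w^2\to0}\frac{\sigma_\ell^2}{\sigma_w^2}=\frac{1}{1-M_1(\epsilon)/\delta}.$$
   Context: Soft thresholding: $\eta_1(u;\lambda)=(|u|-\lambda)\,\mathrm{sign}(u)\,\mathbb{I}(|u|>\lambda)$ for $\lambda\ge0$. State evolution map with optimal thresholding policy: for $\sigma\ge0$, $$\Psi_{\lambda_*,1}(\sigma^2)=\sigma_w^2+\frac1\delta\inf_{\lambda\ge0}\mathbb{E}\left|\eta_1(X+\sigma Z;\lambda)-X\right|^2,$$ with $X$ and $Z\sim N(0,1)$ independent. A fixed point is $\sigma\ge 0$ with $\Psi_{\lambda_*,1}(\sigma^2)=\sigma^2$. A fixed point $\sigma_f>0$ is stable if there is an open interval $I\ni\sigma_f$ such that $\Psi_{\lambda_*,1}(\sigma^2)<\sigma^2$ for all $\sigma>\sigma_f$ in $I$ and $\Psi_{\lambda_*,1}(\sigma^2)>\sigma^2$ for all $\sigma<\sigma_f$ in $I$. $M_1(\epsilon)=\inf_{\tau\ge0}\left[(1-\epsilon)\mathbb{E}(\eta_1^2(Z;\tau))+\epsilon(1+\tau^2)\right]$ with $Z\sim N(0,1)$. *)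

theory Defs
  imports "HOL-Probability.Probability"
begin

definition eta1 :: "real \<Rightarrow> real \<Rightarrow> real" where
  "eta1 u lam = (\<bar>u\<bar> - lam) * sgn u * of_bool (\<bar>u\<bar> > lam)"

text \<open>The state evolution map takes the variance \<open>s = \<sigma>\<^sup>2\<close> as its argument, so that
  \<open>\<sigma> = sqrt s\<close>. Both integrands below are integrable and both families are bounded below by 0
  (in \<open>M1\<close>, for \<open>0 \<le> \<epsilon> \<le> 1\<close>), so the total operators \<open>integral\<close> and \<open>INF\<close> carry their usual
  meaning.\<close>

definition Psi ::
  "'a measure \<Rightarrow> ('a \<Rightarrow> real) \<Rightarrow> ('a \<Rightarrow> real) \<Rightarrow> real \<Rightarrow> real \<Rightarrow> real \<Rightarrow> real" where
  "Psi M X Z \<delta> \<sigma>w s = \<sigma>w\<^sup>2 + 1 / \<delta> *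
     (INF lam\<in>{0..}. integral\<^sup>L M (\<lambda>\<omega>. \<bar>eta1 (X \<omega> + sqrt s * Z \<omega>) lam - X \<omega>\<bar>\<^sup>2))"

definition fixed_point :: "(real \<Rightarrow> real) \<Rightarrow> real \<Rightarrow> bool" where
  "fixed_point \<Psi> \<sigma> \<longleftrightarrow> \<sigma> \<ge> 0 \<and> \<Psi> (\<sigma>\<^sup>2) = \<sigma>\<^sup>2"

definition stable_fixed_point :: "(real \<Rightarrow> real) \<Rightarrow> real \<Rightarrow> bool" where
  "stable_fixed_point \<Psi> \<sigma>f \<longleftrightarrow> fixed_point \<Psi> \<sigma>f \<and> \<sigma>f > 0 \<and>
     (\<exists>a b. \<sigma>f \<in> {a<..<b} \<and>
        (\<forall>\<sigma>\<in>{a<..<b}. \<sigma> \<ge> 0 \<longrightarrow>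
           (\<sigma> > \<sigma>f \<longrightarrow> \<Psi> (\<sigma>\<^sup>2) < \<sigma>\<^sup>2) \<and> (\<sigma> < \<sigma>f \<longrightarrow> \<Psi> (\<sigma>\<^sup>2) > \<sigma>\<^sup>2)))"

definition M1 :: "real \<Rightarrow> real" where
  "M1 \<epsilon> = (INF \<tau>\<in>{0..}.
     (1 - \<epsilon>) * integral\<^sup>L (density lborel (\<lambda>z. ennreal (std_normal_density z))) (\<lambda>z. (eta1 z \<tau>)\<^sup>2)
       + \<epsilon> * (1 + \<tau>\<^sup>2))"

end

theory Submission
  imports Defs
begin

text \<open>Substituting \<open>v = 1 / \<sigma>\<close> and rescaling the threshold by \<open>\<sigma>\<close>, the fixed-point equation becomes
  \<open>\<sigma>\<^sub>w\<^sup>2 v\<^sup>2 + q v / \<delta> = 1\<close>, where \<open>q v\<close> is the infimum over \<open>t \<ge> 0\<close> of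
  \<open>E (Z - clip t (v X + Z))\<^sup>2\<close>. The integrand is nondecreasing in \<open>v \<ge> 0\<close> for each outcome, so \<open>q\<close> is
  nondecreasing; it is also continuous and bounded by \<open>M1 \<epsilon> < \<delta>\<close>. Hence the left-hand side is
  strictly increasing, below 1 at \<open>v = 0\<close>, and takes the value 1 exactly once; the sign change is the
  stability. Since the solution satisfies \<open>\<sigma>\<^sub>w\<^sup>2 v\<^sup>2 = 1 - q v / \<delta> \<ge> 1 - M1 \<epsilon> / \<delta> > 0\<close>, it tends to
  infinity as \<open>\<sigma>\<^sub>w \<rightarrow> 0\<close>, and the limit follows from \<open>q v \<rightarrow> M1 \<epsilon>\<close>. For the latter, the risk
  converges uniformly over thresholds in a bounded interval, and large thresholds are not optimal.\<close>

section \<open>Soft thresholding as the residual of clipping\<close>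

definition clip :: "real \<Rightarrow> real \<Rightarrow> real" where
  "clip t u = max (- t) (min u t)"

lemma clip_measurable [measurable]: "clip t \<in> borel_measurable borel"
  unfolding clip_def by measurable

text \<open>With \<open>u = X + \<sigma> Z\<close>, subtracting \<open>X\<close> leaves
  \<open>\<sigma> Z - clip t u\<close>, so the estimation error involves \<open>X\<close> only
  inside a bounded nonlinearity.\<close>

lemma eta1_eq_diff_clip: "0 \<le> t \<Longrightarrow> eta1 u t = u - clip t u"
  unfolding eta1_def clip_def by (auto simp: sgn_real_def max_def min_def)

lemma clip_mult: "0 < c \<Longrightarrow> clip (c * t) (c * u) = c * clip t u"
  unfolding clip_def by (simp add: max_mult_distrib_left min_mult_distrib_left)

lemma clip_0 [simp]: "clip 0 u = 0"
  unfolding clip_def by simp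

lemma abs_clip_le: "0 \<le> t \<Longrightarrow> \<bar>clip t u\<bar> \<le> t"
  unfolding clip_def by auto

lemma clip_eq_self: "\<bar>u\<bar> \<le> t \<Longrightarrow> clip t u = u"
  unfolding clip_def by auto

lemma abs_clip_diff_le: "\<bar>clip t u - clip t w\<bar> \<le> \<bar>u - w\<bar>"
  unfolding clip_def by auto

text \<open>Let \<open>x \<ge> 0\<close>. If \<open>z > t\<close>, the residual does not depend on
  \<open>v \<ge> 0\<close>; otherwise it is at most 0 at \<open>v = 0\<close> and does not increase
  from there. The case \<open>x < 0\<close> is symmetric.\<close>

lemma clip_error_mono:
  assumes "0 \<le> v" "v \<le> w" "0 \<le> t"
  shows "(z - clip t (v * x + z))\<^sup>2 \<le> (z - clip t (w * x + z))\<^sup>2"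
proof -
  have "(0 \<le> v * x \<and> v * x \<le> w * x) \<or> (w * x \<le> v * x \<and> v * x \<le> 0)"
    using assms by (cases "0 \<le> x") (auto intro: mult_right_mono mult_right_mono_neg mult_nonneg_nonpos)
  then have "\<bar>z - clip t (v * x + z)\<bar> \<le> \<bar>z - clip t (w * x + z)\<bar>"
    using assms(3) unfolding clip_def by (auto simp: max_def min_def abs_if)
  then show ?thesis
    by (simp add: abs_le_square_iff)
qed

text \<open>For \<open>t \<ge> 0\<close> this is the pointwise limit of the clip error as
  \<open>v \<rightarrow> \<infinity>\<close>: a nonzero \<open>x\<close> eventually saturates the
  clip at \<open>t * sgn x\<close>.\<close>

definition limit_error :: "real \<Rightarrow> real \<Rightarrow> real \<Rightarrow> real" where
  "limit_error t x z = (if x = 0 then (z - clip t z)\<^sup>2 else (z - t * sgn x)\<^sup>2)"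

lemma limit_error_0 [simp]: "limit_error 0 x z = z\<^sup>2"
  unfolding limit_error_def by simp

lemma limit_error_measurable [measurable]:
  assumes [measurable]: "f \<in> borel_measurable M" "g \<in> borel_measurable M"
  shows "(\<lambda>\<omega>. limit_error t (f \<omega>) (g \<omega>)) \<in> borel_measurable M"
  unfolding limit_error_def by measurable

lemma clip_error_le_limit_error:
  assumes "0 \<le> v" "0 \<le> t"
  shows "(z - clip t (v * x + z))\<^sup>2 \<le> limit_error t x z"
proof (cases "x = 0")
  case False
  have "(0 < x \<and> 0 \<le> v * x) \<or> (x < 0 \<and> v * x \<le> 0)"
    using assms False by (auto simp: mult_nonneg_nonpos linorder_neq_iff)
  then have "\<bar>z - clip t (v * x + z)\<bar> \<le> \<bar>z - t * sgn x\<bar>"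
    using assms(2) unfolding clip_def by (auto simp: max_def min_def abs_if)
  then show ?thesis
    using False by (simp add: abs_le_square_iff limit_error_def)
qed (simp add: limit_error_def)

lemma limit_error_le:
  assumes "0 \<le> t"
  shows "limit_error t x z \<le> (\<bar>z\<bar> + t)\<^sup>2"
proof -
  have "\<bar>z - clip t z\<bar> \<le> \<bar>\<bar>z\<bar> + t\<bar>"
    using abs_clip_le[OF assms, of z] by linarith
  moreover have "\<bar>z - t * sgn x\<bar> \<le> \<bar>\<bar>z\<bar> + t\<bar>"
    using assms by (auto simp: sgn_real_def)
  ultimately show ?thesis
    unfolding limit_error_def by (simp add: abs_le_square_iff)
qed

text \<open>Once \<open>v * \<bar>x\<bar>\<close> reaches \<open>\<bar>z\<bar> + T\<close>, every
  clip with \<open>t \<le> T\<close> is saturated and the two errors agree; before that the crude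
  bound is added. The added term is free of \<open>t\<close>, which later gives uniformity over
  thresholds.\<close>

lemma limit_error_le_clip_error:
  assumes "0 \<le> v" "0 \<le> t" "t \<le> T"
  shows "limit_error t x z
    \<le> (z - clip t (v * x + z))\<^sup>2 + of_bool (x \<noteq> 0 \<and> v * \<bar>x\<bar> < \<bar>z\<bar> + T) * (\<bar>z\<bar> + T)\<^sup>2"
proof (cases "x \<noteq> 0 \<and> v * \<bar>x\<bar> < \<bar>z\<bar> + T")
  case True
  have "limit_error t x z \<le> (\<bar>z\<bar> + t)\<^sup>2"
    by (rule limit_error_le) fact
  also have "\<dots> \<le> (\<bar>z\<bar> + T)\<^sup>2"
    using assms by (intro power_mono) auto
  finally show ?thesis
    using True by (simp add: add_increasing)
next
  case False
  have "clip t (v * x + z) = t * sgn x" if "x \<noteq> 0"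
  proof -
    have "\<bar>z\<bar> + T \<le> v * \<bar>x\<bar>" using False that by auto
    then show ?thesis
      using that assms unfolding clip_def by (cases "0 < x") (auto simp: max_def min_def)
  qed
  then show ?thesis
    using False by (auto simp: limit_error_def)
qed

section \<open>The normalised risk\<close>

locale soft_threshold_model = prob_space M for M :: "'a measure" +
  fixes X Z :: "'a \<Rightarrow> real"
  assumes X_measurable [measurable]: "X \<in> borel_measurable M"
    and X_square_integrable: "integrable M (\<lambda>\<omega>. (X \<omega>)\<^sup>2)"
    and Z_normal: "distributed M lborel Z (\<lambda>z. ennreal (std_normal_density z))"
    and indep_X_Z: "indep_var borel X borel Z"
begin

section \<open>Moments of the noise and integrability of the errors\<close>

lemma Z_measurable [measurable]: "Z \<in> borel_measurable M"
  using distributed_measurable[OF Z_normal] by simp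

lemma expectation_Z_eq:
  fixes g :: "real \<Rightarrow> real"
  assumes "g \<in> borel_measurable borel"
  shows "expectation (\<lambda>\<omega>. g (Z \<omega>))
    = integral\<^sup>L (density lborel (\<lambda>z. ennreal (std_normal_density z))) g"
  using integral_distr[of Z M lborel g] assms distributed_measurable[OF Z_normal]
  by (simp add: distributed_distr_eq_density[OF Z_normal])

lemma integrable_Z_power: "integrable M (\<lambda>\<omega>. Z \<omega> ^ k)"
  using distributed_integrable[OF Z_normal, of "\<lambda>z. z ^ k"] integrable_std_normal_moment[of k]
  by simp

lemma integrable_Z: "integrable M Z"
  using integrable_Z_power[of 1] by simp

lemma expectation_Z: "expectation Z = 0"
  using standard_normal_distributed_expectation[OF Z_normal] .

lemma expectation_Z_square: "expectation (\<lambda>\<omega>. (Z \<omega>)\<^sup>2) = 1"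
  using standard_normal_distributed_variance[OF Z_normal] by (simp add: expectation_Z)

lemma integrable_abs_Z_plus_square: "integrable M (\<lambda>\<omega>. (\<bar>Z \<omega>\<bar> + t)\<^sup>2)"
  using integrable_Z_power[of 2] integrable_Z
  by (simp add: power2_sum)

lemma integrable_clip_error:
  assumes "0 \<le> v" "0 \<le> t"
  shows "integrable M (\<lambda>\<omega>. (Z \<omega> - clip t (v * X \<omega> + Z \<omega>))\<^sup>2)"
proof (rule Bochner_Integration.integrable_bound[OF integrable_abs_Z_plus_square[of t]])
  show "AE \<omega> in M. norm ((Z \<omega> - clip t (v * X \<omega> + Z \<omega>))\<^sup>2) \<le> norm ((\<bar>Z \<omega>\<bar> + t)\<^sup>2)"
    using order_trans[OF clip_error_le_limit_error[OF assms] limit_error_le[OF assms(2)]] by simp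
qed measurable

lemma integrable_limit_error:
  assumes "0 \<le> t"
  shows "integrable M (\<lambda>\<omega>. limit_error t (X \<omega>) (Z \<omega>))"
proof (rule Bochner_Integration.integrable_bound[OF integrable_abs_Z_plus_square[of t]])
  show "AE \<omega> in M. norm (limit_error t (X \<omega>) (Z \<omega>)) \<le> norm ((\<bar>Z \<omega>\<bar> + t)\<^sup>2)"
    using limit_error_le[OF assms] by (simp add: limit_error_def)
qed measurable

text \<open>With \<open>v = 1 / \<sigma>\<close>, the risk at noise level \<open>\<sigma>\<close> and threshold \<open>\<sigma> * t\<close> is \<open>\<sigma>\<^sup>2 * risk v t\<close>;
  this parametrisation turns the limit \<open>\<sigma> \<rightarrow> \<infinity>\<close> into the regular point \<open>v = 0\<close>.\<close>

definition risk :: "real \<Rightarrow> real \<Rightarrow> real" where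
  "risk v t = expectation (\<lambda>\<omega>. (Z \<omega> - clip t (v * X \<omega> + Z \<omega>))\<^sup>2)"

definition min_risk :: "real \<Rightarrow> real" where
  "min_risk v = (INF t\<in>{0..}. risk v t)"

lemma risk_nonneg: "0 \<le> risk v t"
  unfolding risk_def by simp

lemma bdd_below_risk: "bdd_below (risk v ` {0..})"
  using risk_nonneg by (intro bdd_belowI[of _ 0]) auto

lemma min_risk_le: "0 \<le> t \<Longrightarrow> min_risk v \<le> risk v t"
  unfolding min_risk_def by (intro cINF_lower bdd_below_risk) simp

lemma min_risk_greatest: "(\<And>t. 0 \<le> t \<Longrightarrow> c \<le> risk v t) \<Longrightarrow> c \<le> min_risk v"
  unfolding min_risk_def by (intro cINF_greatest) auto

lemma min_risk_nonneg: "0 \<le> min_risk v"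
  by (intro min_risk_greatest risk_nonneg)

text \<open>At threshold 0 the residual is \<open>Z\<close> itself, of second moment 1.\<close>

lemma min_risk_le_1: "min_risk v \<le> 1"
  using min_risk_le[of 0 v] by (simp add: risk_def expectation_Z_square)

lemma risk_mono:
  assumes "0 \<le> v" "v \<le> w" "0 \<le> t"
  shows "risk v t \<le> risk w t"
  unfolding risk_def using assms
  by (intro integral_mono integrable_clip_error clip_error_mono) auto

lemma min_risk_mono:
  assumes "0 \<le> v" "v \<le> w"
  shows "min_risk v \<le> min_risk w"
  by (rule min_risk_greatest) (meson assms min_risk_le order_trans risk_mono)

text \<open>Soft thresholding is positively homogeneous, so scaling by \<open>\<sigma>\<close> pulls
  out \<open>\<sigma>\<^sup>2\<close>; \<open>t \<mapsto> \<sigma> * t\<close> maps the thresholds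
  onto themselves, so the infima correspond.\<close>

lemma Psi_eq_min_risk:
  assumes "0 < \<sigma>"
  shows "Psi M X Z \<delta> \<sigma>w (\<sigma>\<^sup>2) = \<sigma>w\<^sup>2 + \<sigma>\<^sup>2 * min_risk (1 / \<sigma>) / \<delta>"
proof -
  have scale: "expectation (\<lambda>\<omega>. \<bar>eta1 (X \<omega> + sqrt (\<sigma>\<^sup>2) * Z \<omega>) (\<sigma> * t) - X \<omega>\<bar>\<^sup>2)
      = \<sigma>\<^sup>2 * risk (1 / \<sigma>) t" if "0 \<le> t" for t
  proof -
    have "\<bar>eta1 (x + sqrt (\<sigma>\<^sup>2) * z) (\<sigma> * t) - x\<bar>\<^sup>2 = \<sigma>\<^sup>2 * (z - clip t (1 / \<sigma> * x + z))\<^sup>2" for x z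
    proof -
      have "clip (\<sigma> * t) (x + \<sigma> * z) = \<sigma> * clip t (1 / \<sigma> * x + z)"
        using clip_mult[OF assms, of t "1 / \<sigma> * x + z"] assms by (simp add: distrib_left)
      then have "eta1 (x + sqrt (\<sigma>\<^sup>2) * z) (\<sigma> * t) - x = \<sigma> * (z - clip t (1 / \<sigma> * x + z))"
        using assms that by (simp add: eta1_eq_diff_clip right_diff_distrib)
      then show ?thesis by (simp add: power_mult_distrib)
    qed
    then show ?thesis unfolding risk_def by simp
  qed
  let ?F = "\<lambda>lam. expectation (\<lambda>\<omega>. \<bar>eta1 (X \<omega> + sqrt (\<sigma>\<^sup>2) * Z \<omega>) lam - X \<omega>\<bar>\<^sup>2)"
  have "(INF lam\<in>{0..}. ?F lam) = \<sigma>\<^sup>2 * min_risk (1 / \<sigma>)"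
  proof (rule antisym)
    have "(INF lam\<in>{0..}. ?F lam) / \<sigma>\<^sup>2 \<le> min_risk (1 / \<sigma>)"
    proof (rule min_risk_greatest)
      fix t :: real assume t: "0 \<le> t"
      have "(INF lam\<in>{0..}. ?F lam) \<le> ?F (\<sigma> * t)"
        using t assms by (intro cINF_lower bdd_belowI[of _ 0]) auto
      then show "(INF lam\<in>{0..}. ?F lam) / \<sigma>\<^sup>2 \<le> risk (1 / \<sigma>) t"
        using assms by (simp only: scale[OF t]) (simp add: field_simps)
    qed
    then show "(INF lam\<in>{0..}. ?F lam) \<le> \<sigma>\<^sup>2 * min_risk (1 / \<sigma>)"
      using assms by (simp add: field_simps)
    show "\<sigma>\<^sup>2 * min_risk (1 / \<sigma>) \<le> (INF lam\<in>{0..}. ?F lam)"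
    proof (rule cINF_greatest)
      fix lam :: real assume "lam \<in> {0..}"
      then have "0 \<le> lam / \<sigma>" using assms by simp
      then show "\<sigma>\<^sup>2 * min_risk (1 / \<sigma>) \<le> ?F lam"
        using scale[of "lam / \<sigma>"] min_risk_le[of "lam / \<sigma>" "1 / \<sigma>"] assms by simp
    qed simp
  qed
  then show ?thesis
    unfolding Psi_def by simp
qed

text \<open>Treats \<open>\<sigma> = 0\<close>, which the substitution
  \<open>v = 1 / \<sigma>\<close> does not reach.\<close>

lemma Psi_0_ge:
  assumes "0 < \<delta>"
  shows "\<sigma>w\<^sup>2 \<le> Psi M X Z \<delta> \<sigma>w 0"
  unfolding Psi_def using assms by (auto intro!: divide_nonneg_pos cINF_greatest)

text \<open>Clipping is 1-Lipschitz, so changing \<open>v\<close> to \<open>w\<close> moves the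
  residual by at most \<open>d * \<bar>x\<bar>\<close>, uniformly in the threshold; the second
  moment of \<open>X\<close> controls this change.\<close>

lemma min_risk_diff_le:
  assumes "0 \<le> v" "0 \<le> w" "v \<noteq> w"
  defines "d \<equiv> \<bar>v - w\<bar>"
  shows "min_risk v - min_risk w \<le> d + (d\<^sup>2 + d) * expectation (\<lambda>\<omega>. (X \<omega>)\<^sup>2)"
proof -
  let ?K = "expectation (\<lambda>\<omega>. (X \<omega>)\<^sup>2)"
  have d: "0 < d" using assms by simp
  \<comment> \<open>Young's inequality with weight \<open>d\<close> itself: the shift has square at
    most \<open>d\<^sup>2 * x\<^sup>2\<close>, and
    \<open>(1 + 1 / d) * d\<^sup>2 = d\<^sup>2 + d\<close> still vanishes with
    \<open>d\<close>.\<close>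
  have young: "(a + b)\<^sup>2 \<le> (1 + d) * a\<^sup>2 + (1 + 1 / d) * b\<^sup>2" for a b :: real
  proof -
    have "0 \<le> (d * a - b)\<^sup>2 / d" using d by simp
    also have "\<dots> = d * a\<^sup>2 + b\<^sup>2 / d - 2 * a * b"
      using d by (simp add: power2_eq_square field_simps)
    finally show ?thesis by (simp add: power2_sum algebra_simps)
  qed
  have pt: "(z - clip t (v * x + z))\<^sup>2 \<le> (1 + d) * (z - clip t (w * x + z))\<^sup>2 + (d\<^sup>2 + d) * x\<^sup>2"
    for t x z :: real
  proof -
    define b where "b = clip t (w * x + z) - clip t (v * x + z)"
    have "\<bar>b\<bar> \<le> \<bar>(w * x + z) - (v * x + z)\<bar>"
      unfolding b_def by (rule abs_clip_diff_le)
    also have "\<dots> = d * \<bar>x\<bar>"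
      unfolding d_def by (simp add: left_diff_distrib abs_minus_commute flip: abs_mult)
    finally have "b\<^sup>2 \<le> (d * \<bar>x\<bar>)\<^sup>2" using power_mono[of "\<bar>b\<bar>" _ 2] by simp
    then have "(1 + 1 / d) * b\<^sup>2 \<le> (1 + 1 / d) * (d\<^sup>2 * x\<^sup>2)"
      using d by (intro mult_left_mono) (auto simp: power_mult_distrib)
    also have "\<dots> = (d\<^sup>2 + d) * x\<^sup>2"
      using d by (simp add: field_simps power2_eq_square)
    finally show ?thesis
      using young[of "z - clip t (w * x + z)" b] by (simp add: b_def)
  qed
  have "risk v t \<le> (1 + d) * risk w t + (d\<^sup>2 + d) * ?K" if t: "0 \<le> t" for t
  proof -
    note [simp] = integrable_clip_error[OF _ t] X_square_integrable
    have "risk v t \<le> expectation (\<lambda>\<omega>.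
        (1 + d) * (Z \<omega> - clip t (w * X \<omega> + Z \<omega>))\<^sup>2 + (d\<^sup>2 + d) * (X \<omega>)\<^sup>2)"
      unfolding risk_def using assms by (intro integral_mono pt) auto
    also have "\<dots> = (1 + d) * risk w t + (d\<^sup>2 + d) * ?K"
      unfolding risk_def using assms(2) by simp
    finally show ?thesis .
  qed
  \<comment> \<open>Solving for \<open>risk w t\<close> leaves a bound free of \<open>t\<close>, so
    the infimum over \<open>t\<close> can be taken.\<close>
  then have "(min_risk v - (d\<^sup>2 + d) * ?K) / (1 + d) \<le> risk w t" if "0 \<le> t" for t
    using order_trans[OF min_risk_le[OF that, of v]] that d by (simp add: field_simps)
  then have "(min_risk v - (d\<^sup>2 + d) * ?K) / (1 + d) \<le> min_risk w"
    by (rule min_risk_greatest)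
  then have "min_risk v \<le> min_risk w + d * min_risk w + (d\<^sup>2 + d) * ?K"
    using d by (simp add: field_simps)
  moreover have "d * min_risk w \<le> d"
    using d min_risk_le_1[of w] by (simp add: mult_left_le)
  ultimately show ?thesis by simp
qed

lemma continuous_on_min_risk: "continuous_on {0..} min_risk"
  unfolding continuous_on_def
proof
  fix w :: real assume w: "w \<in> {0..}"
  let ?B = "\<lambda>v. \<bar>v - w\<bar> + (\<bar>v - w\<bar>\<^sup>2 + \<bar>v - w\<bar>) * expectation (\<lambda>\<omega>. (X \<omega>)\<^sup>2)"
  have "\<forall>\<^sub>F v in at w within {0..}. norm (min_risk v - min_risk w) \<le> ?B v"
    \<comment> \<open>The punctured filter supplies \<open>v \<noteq> w\<close>, needed because the
      bound was derived with \<open>1 / d\<close>.\<close>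
    unfolding eventually_at_filter
  proof (intro always_eventually allI impI)
    fix v :: real assume "v \<noteq> w" "v \<in> {0..}"
    then show "norm (min_risk v - min_risk w) \<le> ?B v"
      using w min_risk_diff_le[of v w] min_risk_diff_le[of w v]
      by (auto simp: abs_le_iff abs_minus_commute)
  qed
  moreover have "(?B \<longlongrightarrow> 0) (at w within {0..})"
    by (auto intro!: tendsto_eq_intros)
  ultimately have "((\<lambda>v. min_risk v - min_risk w) \<longlongrightarrow> 0) (at w within {0..})"
    by (rule Lim_null_comparison)
  then show "(min_risk \<longlongrightarrow> min_risk w) (at w within {0..})"
    by (simp add: LIM_zero_iff)
qed

section \<open>The limit of small noise\<close>

definition signal_prob :: real where
  "signal_prob = prob {\<omega> \<in> space M. X \<omega> \<noteq> 0}"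

definition limit_risk :: "real \<Rightarrow> real" where
  "limit_risk t = expectation (\<lambda>\<omega>. limit_error t (X \<omega>) (Z \<omega>))"

lemma expectation_mult_indep:
  fixes f g :: "real \<Rightarrow> real"
  assumes "f \<in> borel_measurable borel" "g \<in> borel_measurable borel"
    and "integrable M (\<lambda>\<omega>. f (X \<omega>))" "integrable M (\<lambda>\<omega>. g (Z \<omega>))"
  shows "integrable M (\<lambda>\<omega>. f (X \<omega>) * g (Z \<omega>))"
    and "expectation (\<lambda>\<omega>. f (X \<omega>) * g (Z \<omega>))
      = expectation (\<lambda>\<omega>. f (X \<omega>)) * expectation (\<lambda>\<omega>. g (Z \<omega>))"
proof -
  have "indep_var borel (\<lambda>\<omega>. f (X \<omega>)) borel (\<lambda>\<omega>. g (Z \<omega>))"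
    using indep_var_compose[OF indep_X_Z assms(1,2)] by (simp add: comp_def)
  from indep_var_integrable[OF this assms(3,4)] indep_var_lebesgue_integral[OF this assms(3,4)]
  show "integrable M (\<lambda>\<omega>. f (X \<omega>) * g (Z \<omega>))"
    and "expectation (\<lambda>\<omega>. f (X \<omega>) * g (Z \<omega>))
      = expectation (\<lambda>\<omega>. f (X \<omega>)) * expectation (\<lambda>\<omega>. g (Z \<omega>))" .
qed

lemma expectation_X_neq_0: "expectation (\<lambda>\<omega>. of_bool (X \<omega> \<noteq> 0)) = signal_prob"
proof -
  have "expectation (\<lambda>\<omega>. of_bool (X \<omega> \<noteq> 0))
      = expectation (indicat_real {\<omega> \<in> space M. X \<omega> \<noteq> 0})"
    by (intro Bochner_Integration.integral_cong) (auto simp: indicator_def)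
  also have "\<dots> = signal_prob"
    unfolding signal_prob_def by (simp add: Int_absorb2)
  finally show ?thesis .
qed

text \<open>Where \<open>X = 0\<close> the error is that of thresholding pure noise; where
  \<open>X \<noteq> 0\<close> it is \<open>(Z - t * sgn X)\<^sup>2\<close>, whose cross term has
  mean 0 by independence. This identifies the objective in \<open>M1\<close>.\<close>

lemma limit_risk_eq:
  assumes t: "0 \<le> t"
  shows "limit_risk t = (1 - signal_prob) *
      integral\<^sup>L (density lborel (\<lambda>z. ennreal (std_normal_density z))) (\<lambda>z. (eta1 z t)\<^sup>2)
    + signal_prob * (1 + t\<^sup>2)"
proof -
  let ?N = "\<lambda>\<omega>. of_bool (X \<omega> \<noteq> 0) :: real"
  let ?C = "\<lambda>z. (z - clip t z)\<^sup>2"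
  have int_N: "integrable M ?N"
    by (rule integrable_const_bound[of _ 1]) auto
  have int_sgn: "integrable M (\<lambda>\<omega>. sgn (X \<omega>))"
    by (rule integrable_const_bound[of _ 1]) (auto simp: sgn_real_def)
  have int_C: "integrable M (\<lambda>\<omega>. ?C (Z \<omega>))"
    using integrable_clip_error[of 0 t] t by simp
  note int_Z2 = integrable_Z_power[of 2]
  have int_0: "integrable M (\<lambda>\<omega>. 1 - ?N \<omega>)"
    using int_N by simp
  have meas: "(\<lambda>x::real. 1 - of_bool (x \<noteq> 0) :: real) \<in> borel_measurable borel"
    "(\<lambda>x::real. of_bool (x \<noteq> 0) :: real) \<in> borel_measurable borel"
    "?C \<in> borel_measurable borel" "(\<lambda>z::real. z\<^sup>2) \<in> borel_measurable borel"
    "(sgn :: real \<Rightarrow> real) \<in> borel_measurable borel" "(\<lambda>z::real. z) \<in> borel_measurable borel"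
    by measurable
  note zero = expectation_mult_indep[OF meas(1,3) int_0 int_C]
  note nonzero = expectation_mult_indep[OF meas(2,4) int_N int_Z2]
  note cross = expectation_mult_indep[OF meas(5,6) int_sgn integrable_Z]
  \<comment> \<open>Each summand is a constant times a function of \<open>x\<close> times a function
    of \<open>z\<close>, so independence applies termwise; \<open>sgn x\<close> already vanishes at
    0, so the cross term needs no indicator.\<close>
  have decomp: "limit_error t x z = (1 - of_bool (x \<noteq> 0)) * ?C z + of_bool (x \<noteq> 0) * z\<^sup>2
      + of_bool (x \<noteq> 0) * t\<^sup>2 - 2 * t * (sgn x * z)" for x z
    unfolding limit_error_def by (auto simp: sgn_real_def power2_eq_square algebra_simps)
  have "limit_risk t = expectation (\<lambda>\<omega>. (1 - ?N \<omega>) * ?C (Z \<omega>)) + expectation (\<lambda>\<omega>. ?N \<omega> * (Z \<omega>)\<^sup>2)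
      + expectation ?N * t\<^sup>2 - 2 * t * expectation (\<lambda>\<omega>. sgn (X \<omega>) * Z \<omega>)"
    unfolding limit_risk_def decomp
    by (simp only: Bochner_Integration.integral_add Bochner_Integration.integral_diff
        Bochner_Integration.integrable_add integrable_mult_right integrable_mult_left
        integral_mult_right_zero integral_mult_left_zero zero(1) nonzero(1) cross(1) int_N)
  also have "expectation (\<lambda>\<omega>. (1 - ?N \<omega>) * ?C (Z \<omega>)) = (1 - signal_prob) * expectation (\<lambda>\<omega>. ?C (Z \<omega>))"
    using int_N by (simp only: zero(2) Bochner_Integration.integral_diff integrable_const expectation_X_neq_0)
      (simp add: prob_space)
  also have "expectation (\<lambda>\<omega>. ?N \<omega> * (Z \<omega>)\<^sup>2) = signal_prob"
    by (simp only: nonzero(2) expectation_Z_square expectation_X_neq_0 mult_1_right)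
  also have "expectation (\<lambda>\<omega>. sgn (X \<omega>) * Z \<omega>) = 0"
    by (simp only: cross(2) expectation_Z mult_zero_right)
  also have "expectation ?N = signal_prob"
    by (rule expectation_X_neq_0)
  also have "expectation (\<lambda>\<omega>. ?C (Z \<omega>))
      = integral\<^sup>L (density lborel (\<lambda>z. ennreal (std_normal_density z))) ?C"
    by (rule expectation_Z_eq) measurable
  finally show ?thesis
    using t by (simp add: eta1_eq_diff_clip distrib_left)
qed

section \<open>Comparison of the minimal risk with \<open>M1\<close>\<close>

lemma limit_risk_nonneg: "0 \<le> limit_risk t"
  unfolding limit_risk_def by (simp add: limit_error_def)

lemma M1_eq_INF_limit_risk: "M1 signal_prob = (INF t\<in>{0..}. limit_risk t)"
  unfolding M1_def using limit_risk_eq by (intro INF_cong) auto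

lemma M1_le_limit_risk: "0 \<le> t \<Longrightarrow> M1 signal_prob \<le> limit_risk t"
  unfolding M1_eq_INF_limit_risk using limit_risk_nonneg
  by (intro cINF_lower bdd_belowI[of _ 0]) auto

lemma M1_le_1: "M1 signal_prob \<le> 1"
  using M1_le_limit_risk[of 0] by (simp add: limit_risk_def expectation_Z_square)

lemma min_risk_le_M1:
  assumes "0 \<le> v"
  shows "min_risk v \<le> M1 signal_prob"
  unfolding M1_eq_INF_limit_risk
proof (rule cINF_greatest)
  fix t :: real assume "t \<in> {0..}"
  then have t: "0 \<le> t" by simp
  have "min_risk v \<le> risk v t"
    by (rule min_risk_le[OF t])
  also have "\<dots> \<le> limit_risk t"
    unfolding risk_def limit_risk_def using assms t
    by (intro integral_mono integrable_clip_error integrable_limit_error clip_error_le_limit_error)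
  finally show "min_risk v \<le> limit_risk t" .
qed simp

text \<open>As \<open>t \<rightarrow> \<infinity>\<close> the estimator vanishes and the risk tends to \<open>v\<^sup>2 * E X\<^sup>2\<close>, so large thresholds
  cannot be optimal once \<open>v\<close> is large.\<close>

lemma risk_ge_1_large_threshold:
  assumes K: "0 < expectation (\<lambda>\<omega>. (X \<omega>)\<^sup>2)"
  obtains v T where "0 \<le> v" "0 \<le> T" "\<And>t. T \<le> t \<Longrightarrow> 1 \<le> risk v t"
proof -
  \<comment> \<open>Chosen so that \<open>v\<^sup>2 * E X\<^sup>2 = 2\<close>, safely above the
    target 1.\<close>
  define v where "v = sqrt (2 / expectation (\<lambda>\<omega>. (X \<omega>)\<^sup>2))"
  have v: "0 \<le> v" unfolding v_def using K by simp
  \<comment> \<open>On this event a clip at any \<open>t \<ge> n\<close> is the identity and the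
    error is exactly \<open>v\<^sup>2 * (X \<omega>)\<^sup>2\<close>, so \<open>?g n\<close> is a
    lower bound for all such \<open>t\<close> at once.\<close>
  let ?g = "\<lambda>(n::nat) \<omega>. v\<^sup>2 * (X \<omega>)\<^sup>2 * of_bool (\<bar>v * X \<omega> + Z \<omega>\<bar> \<le> real n)"
  have "(\<lambda>n. expectation (?g n)) \<longlonglongrightarrow> expectation (\<lambda>\<omega>. v\<^sup>2 * (X \<omega>)\<^sup>2)"
  proof (rule integral_dominated_convergence[where w = "\<lambda>\<omega>. v\<^sup>2 * (X \<omega>)\<^sup>2"])
    show "AE \<omega> in M. (\<lambda>n. ?g n \<omega>) \<longlonglongrightarrow> v\<^sup>2 * (X \<omega>)\<^sup>2"
    proof (rule AE_I2)
      fix \<omega>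
      have "\<forall>\<^sub>F n in sequentially. \<bar>v * X \<omega> + Z \<omega>\<bar> \<le> real n"
        using real_nat_ceiling_ge[of "\<bar>v * X \<omega> + Z \<omega>\<bar>"]
        by (intro eventually_sequentiallyI[of "nat \<lceil>\<bar>v * X \<omega> + Z \<omega>\<bar>\<rceil>"]) linarith
      then show "(\<lambda>n. ?g n \<omega>) \<longlonglongrightarrow> v\<^sup>2 * (X \<omega>)\<^sup>2"
        by (intro tendsto_eventually) (auto elim: eventually_mono)
    qed
  qed (use X_square_integrable in \<open>auto\<close>)
  moreover have "1 < expectation (\<lambda>\<omega>. v\<^sup>2 * (X \<omega>)\<^sup>2)"
    unfolding v_def using K by simp
  ultimately obtain n where n: "1 < expectation (?g n)"
    using order_tendstoD(1) eventually_happens by (metis (no_types, lifting) sequentially_bot)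
  show thesis
  proof
    fix t assume t: "real n \<le> t"
    have "expectation (?g n) \<le> risk v t"
      unfolding risk_def
    proof (rule integral_mono)
      show "integrable M (?g n)"
        by (rule Bochner_Integration.integrable_bound[where f = "\<lambda>\<omega>. v\<^sup>2 * (X \<omega>)\<^sup>2"])
          (use X_square_integrable in auto)
      show "integrable M (\<lambda>\<omega>. (Z \<omega> - clip t (v * X \<omega> + Z \<omega>))\<^sup>2)"
        using v t by (intro integrable_clip_error) auto
      show "?g n \<omega> \<le> (Z \<omega> - clip t (v * X \<omega> + Z \<omega>))\<^sup>2" for \<omega>
        using t by (auto simp: clip_eq_self power_mult_distrib)
    qed
    then show "1 \<le> risk v t"
      using n by simp
  qed (use v in auto)
qed

text \<open>The excess is at most the expectation of \<open>?W n\<close>, which is free of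
  \<open>t\<close> and tends to 0 by dominated convergence.\<close>

lemma limit_risk_le_risk_bounded_threshold:
  assumes "0 \<le> T" "0 < e"
  obtains w where "0 \<le> w" "\<And>v t. w \<le> v \<Longrightarrow> 0 \<le> t \<Longrightarrow> t \<le> T \<Longrightarrow> limit_risk t \<le> risk v t + e"
proof -
  let ?W = "\<lambda>(n::nat) \<omega>. of_bool (X \<omega> \<noteq> 0 \<and> real n * \<bar>X \<omega>\<bar> < \<bar>Z \<omega>\<bar> + T) * (\<bar>Z \<omega>\<bar> + T)\<^sup>2"
  have int_W: "integrable M (?W n)" for n
    by (rule Bochner_Integration.integrable_bound[OF integrable_abs_Z_plus_square[of T]]) auto
  have "(\<lambda>n. expectation (?W n)) \<longlonglongrightarrow> expectation (\<lambda>\<omega>. 0)"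
  proof (rule integral_dominated_convergence[where w = "\<lambda>\<omega>. (\<bar>Z \<omega>\<bar> + T)\<^sup>2"])
    show "AE \<omega> in M. (\<lambda>n. ?W n \<omega>) \<longlonglongrightarrow> 0"
    proof (rule AE_I2)
      fix \<omega>
      have "\<forall>\<^sub>F n in sequentially. \<not> (X \<omega> \<noteq> 0 \<and> real n * \<bar>X \<omega>\<bar> < \<bar>Z \<omega>\<bar> + T)"
      proof (cases "X \<omega> = 0")
        case False
        then show ?thesis
          using real_nat_ceiling_ge[of "(\<bar>Z \<omega>\<bar> + T) / \<bar>X \<omega>\<bar>"]
          by (intro eventually_sequentiallyI[of "nat \<lceil>(\<bar>Z \<omega>\<bar> + T) / \<bar>X \<omega>\<bar>\<rceil>"])
            (auto simp: not_less pos_divide_le_eq[symmetric])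
      qed simp
      then show "(\<lambda>n. ?W n \<omega>) \<longlonglongrightarrow> 0"
        by (intro tendsto_eventually) (erule eventually_mono, simp)
    qed
  qed (use integrable_abs_Z_plus_square in auto)
  then have "\<forall>\<^sub>F n in sequentially. expectation (?W n) < e"
    using \<open>0 < e\<close> by (intro order_tendstoD(2)) auto
  then obtain n where n: "expectation (?W n) < e"
    using eventually_happens by (metis (no_types, lifting) sequentially_bot)
  show thesis
  proof
    fix v t assume v: "real n \<le> v" and t: "0 \<le> t" "t \<le> T"
    have "limit_risk t \<le> expectation (\<lambda>\<omega>. (Z \<omega> - clip t (real n * X \<omega> + Z \<omega>))\<^sup>2 + ?W n \<omega>)"
      unfolding limit_risk_def using t
      by (intro integral_mono integrable_limit_error limit_error_le_clip_error
          Bochner_Integration.integrable_add integrable_clip_error int_W) auto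
    also have "\<dots> = risk (real n) t + expectation (?W n)"
      unfolding risk_def using t
      by (intro Bochner_Integration.integral_add integrable_clip_error int_W) auto
    \<comment> \<open>Monotonicity in \<open>v\<close> passes from the integer \<open>n\<close> to
      all larger reals.\<close>
    also have "\<dots> \<le> risk v t + e"
      using n risk_mono[OF _ v t(1)] by simp
    finally show "limit_risk t \<le> risk v t + e" .
  qed simp
qed

text \<open>If \<open>X = 0\<close> almost surely, risk and limit risk coincide. Otherwise
  thresholds up to \<open>T\<close> are covered by the uniform estimate, and beyond \<open>T\<close>
  the risk is at least 1.\<close>

lemma M1_le_min_risk:
  assumes "0 < e"
  obtains w where "\<And>v. w \<le> v \<Longrightarrow> M1 signal_prob \<le> min_risk v + e"
proof (cases "expectation (\<lambda>\<omega>. (X \<omega>)\<^sup>2) = 0")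
  case True
  then have X0: "AE \<omega> in M. X \<omega> = 0"
    using integral_nonneg_eq_0_iff_AE[OF X_square_integrable] by simp
  have "risk v t = limit_risk t" for v t
    unfolding risk_def limit_risk_def
    by (rule integral_cong_AE) (use X0 in \<open>auto simp: limit_error_def\<close>)
  then have "M1 signal_prob \<le> min_risk v" for v
    by (intro min_risk_greatest) (simp add: M1_le_limit_risk)
  then show thesis
    using that assms by (meson add_increasing2 less_imp_le)
next
  case False
  then have "0 < expectation (\<lambda>\<omega>. (X \<omega>)\<^sup>2)"
    by (simp add: order_less_le)
  then obtain u T where u: "0 \<le> u" and T: "0 \<le> T" "\<And>t. T \<le> t \<Longrightarrow> 1 \<le> risk u t"
    using risk_ge_1_large_threshold by blast
  from T(1) assms obtain w where
    w: "\<And>v t. w \<le> v \<Longrightarrow> 0 \<le> t \<Longrightarrow> t \<le> T \<Longrightarrow> limit_risk t \<le> risk v t + e"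
    using limit_risk_le_risk_bounded_threshold by blast
  show thesis
  proof
    fix v assume v: "max u w \<le> v"
    have "M1 signal_prob - e \<le> min_risk v"
    proof (rule min_risk_greatest)
      fix t :: real assume t: "0 \<le> t"
      show "M1 signal_prob - e \<le> risk v t"
      proof (cases "t \<le> T")
        case True
        then show ?thesis
          using w[of v t] M1_le_limit_risk[OF t] v t by simp
      next
        \<comment> \<open>Here
          \<open>M1 signal_prob \<le> 1 \<le> risk u t \<le> risk v t\<close>.\<close>
        case False
        then show ?thesis
          using T(2)[of t] risk_mono[OF u, of v t] M1_le_1 v t assms by simp
      qed
    qed
    then show "M1 signal_prob \<le> min_risk v + e" by simp
  qed
qed

lemma min_risk_tendsto: "(min_risk \<longlongrightarrow> M1 signal_prob) at_top"
proof (rule tendstoI)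
  fix e :: real assume "0 < e"
  then obtain w where w: "\<And>v. w \<le> v \<Longrightarrow> M1 signal_prob \<le> min_risk v + e / 2"
    using M1_le_min_risk[of "e / 2"] by auto
  have "dist (min_risk v) (M1 signal_prob) < e" if "max 0 w \<le> v" for v
    using w[of v] min_risk_le_M1[of v] that \<open>0 < e\<close> by (simp add: dist_real_def)
  then show "\<forall>\<^sub>F v in at_top. dist (min_risk v) (M1 signal_prob) < e"
    by (rule eventually_at_top_linorderI)
qed

section \<open>The fixed-point equation\<close>

text \<open>Dividing the fixed-point equation by \<open>\<sigma>\<^sup>2\<close> and writing \<open>v = 1 / \<sigma>\<close> turns it into
  \<open>level \<delta> \<sigma>w v = 1\<close>.\<close>

definition level :: "real \<Rightarrow> real \<Rightarrow> real \<Rightarrow> real" where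
  "level \<delta> \<sigma>w v = \<sigma>w\<^sup>2 * v\<^sup>2 + min_risk v / \<delta>"

lemma Psi_eq_level:
  assumes "0 < \<sigma>"
  shows "Psi M X Z \<delta> \<sigma>w (\<sigma>\<^sup>2) = \<sigma>\<^sup>2 * level \<delta> \<sigma>w (1 / \<sigma>)"
  using assms unfolding Psi_eq_min_risk[OF assms] level_def by (simp add: field_simps)

text \<open>Strictness comes from the quadratic term; \<open>min_risk\<close> is only known to be
  nondecreasing.\<close>

lemma level_strict_mono:
  assumes "0 < \<delta>" "0 < \<sigma>w" "0 \<le> v" "v < w"
  shows "level \<delta> \<sigma>w v < level \<delta> \<sigma>w w"
  unfolding level_def using assms
  by (intro add_less_le_mono mult_strict_left_mono power_strict_mono divide_right_mono min_risk_mono) auto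

lemma level_eq_1_ex:
  assumes "0 < \<delta>" "M1 signal_prob < \<delta>" "0 < \<sigma>w"
  shows "\<exists>v>0. level \<delta> \<sigma>w v = 1"
proof -
  have at_0: "level \<delta> \<sigma>w 0 < 1"
    unfolding level_def using assms min_risk_le_M1[of 0] by simp
  \<comment> \<open>At \<open>v = 1 / \<sigma>w\<close> the quadratic term alone equals 1.\<close>
  moreover have "1 \<le> level \<delta> \<sigma>w (1 / \<sigma>w)"
    unfolding level_def using assms min_risk_nonneg by (simp add: power_divide)
  moreover have "continuous_on {0..1 / \<sigma>w} (level \<delta> \<sigma>w)"
    unfolding level_def using assms(1)
    by (intro continuous_intros continuous_on_subset[OF continuous_on_min_risk]) auto
  ultimately obtain v where "0 \<le> v" "level \<delta> \<sigma>w v = 1"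
    using IVT'[of "level \<delta> \<sigma>w" 0 1 "1 / \<sigma>w"] assms(3) by auto
  with at_0 show ?thesis
    by (metis less_irrefl order_less_le)
qed

lemma fixed_point_iff_level:
  assumes "0 < \<sigma>w" "0 < \<delta>"
  shows "fixed_point (Psi M X Z \<delta> \<sigma>w) \<sigma> \<longleftrightarrow> 0 < \<sigma> \<and> level \<delta> \<sigma>w (1 / \<sigma>) = 1"
proof (cases "0 < \<sigma>")
  case True
  then show ?thesis
    by (simp add: fixed_point_def Psi_eq_level)
next
  case False
  have "0 < Psi M X Z \<delta> \<sigma>w 0"
    using Psi_0_ge[OF assms(2), of \<sigma>w] assms(1) by (smt (verit) zero_less_power)
  with False show ?thesis
    by (auto simp: fixed_point_def order_le_less)
qed

lemma stable_fixed_point_of_level: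
  assumes "0 < \<sigma>w" "0 < \<delta>" "0 < v" "level \<delta> \<sigma>w v = 1"
  shows "stable_fixed_point (Psi M X Z \<delta> \<sigma>w) (1 / v)"
  unfolding stable_fixed_point_def
proof (intro conjI exI ballI impI)
  show "fixed_point (Psi M X Z \<delta> \<sigma>w) (1 / v)"
    using assms by (simp add: fixed_point_iff_level)
  \<comment> \<open>The sign conditions hold for every \<open>\<sigma> \<ge> 0\<close>, so any open
    interval around \<open>1 / v\<close> would serve.\<close>
  show "1 / v \<in> {-1<..<1 / v + 1}"
    using assms(3) by (simp add: less_le_trans[of _ 0])
next
  fix \<sigma> assume "1 / v < \<sigma>"
  moreover from this have "0 < \<sigma>"
    using assms(3) by (meson divide_pos_pos less_trans zero_less_one)
  ultimately have "1 / \<sigma> < v"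
    using assms(3) by (simp add: field_simps)
  then show "Psi M X Z \<delta> \<sigma>w (\<sigma>\<^sup>2) < \<sigma>\<^sup>2"
    using level_strict_mono[of \<delta> \<sigma>w "1 / \<sigma>" v] assms \<open>0 < \<sigma>\<close> by (simp add: Psi_eq_level)
next
  fix \<sigma> assume "0 \<le> \<sigma>" "\<sigma> < 1 / v"
  show "\<sigma>\<^sup>2 < Psi M X Z \<delta> \<sigma>w (\<sigma>\<^sup>2)"
  proof (cases "\<sigma> = 0")
    case True
    then show ?thesis
      using Psi_0_ge[OF assms(2), of \<sigma>w] assms(1) by (smt (verit) zero_less_power zero_power2)
  next
    case False
    with \<open>0 \<le> \<sigma>\<close> have "0 < \<sigma>" by simp
    moreover from this \<open>\<sigma> < 1 / v\<close> have "v < 1 / \<sigma>"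
      using assms(3) by (simp add: field_simps)
    ultimately show ?thesis
      using level_strict_mono[of \<delta> \<sigma>w v "1 / \<sigma>"] assms by (simp add: Psi_eq_level)
  qed
qed (use assms in auto)

text \<open>By the level equation the ratio equals
  \<open>1 / (1 - min_risk (v \<sigma>w) / \<delta>)\<close> exactly, so it remains to show that
  \<open>v \<sigma>w\<close> tends to infinity.\<close>

lemma level_solution_ratio_tendsto:
  assumes "0 < \<delta>" "M1 signal_prob < \<delta>"
    and v: "\<And>\<sigma>w. 0 < \<sigma>w \<Longrightarrow> 0 < v \<sigma>w \<and> level \<delta> \<sigma>w (v \<sigma>w) = 1"
  shows "((\<lambda>\<sigma>w. (1 / v \<sigma>w)\<^sup>2 / \<sigma>w\<^sup>2) \<longlongrightarrow> 1 / (1 - M1 signal_prob / \<delta>)) (at_right 0)"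
proof -
  define c where "c = 1 - M1 signal_prob / \<delta>"
  have c: "0 < c" unfolding c_def using assms by simp
  have sol: "\<sigma>w\<^sup>2 * (v \<sigma>w)\<^sup>2 = 1 - min_risk (v \<sigma>w) / \<delta>" if "0 < \<sigma>w" for \<sigma>w
    using v[OF that] unfolding level_def by simp
  have pos: "\<forall>\<^sub>F \<sigma>w in at_right 0. 0 < (\<sigma>w::real)"
    by (simp add: eventually_at_right_less)
  \<comment> \<open>As \<open>min_risk\<close> never exceeds \<open>M1 signal_prob\<close>, the
    product \<open>\<sigma>w * v \<sigma>w\<close> stays above \<open>sqrt c\<close>, which forces
    \<open>v \<sigma>w\<close> to blow up.\<close>
  have bound: "sqrt c * inverse \<sigma>w \<le> v \<sigma>w" if "0 < \<sigma>w" for \<sigma>w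
  proof -
    have "c \<le> (\<sigma>w * v \<sigma>w)\<^sup>2"
      using sol[OF that] min_risk_le_M1[of "v \<sigma>w"] v[OF that] assms(1)
      by (simp add: c_def power_mult_distrib divide_right_mono)
    then have "sqrt c \<le> \<sigma>w * v \<sigma>w"
      using v[OF that] that by (intro real_le_lsqrt) auto
    then show ?thesis
      using that by (simp add: field_simps)
  qed
  have "filterlim (\<lambda>\<sigma>w. sqrt c * inverse \<sigma>w) at_top (at_right 0)"
    using c by (intro filterlim_tendsto_pos_mult_at_top[OF tendsto_const _ filterlim_inverse_at_top_right]) simp
  then have "filterlim v at_top (at_right 0)"
    by (rule filterlim_at_top_mono) (use pos bound in \<open>auto elim: eventually_mono\<close>)
  then have "((\<lambda>\<sigma>w. min_risk (v \<sigma>w)) \<longlongrightarrow> M1 signal_prob) (at_right 0)"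
    by (rule filterlim_compose[OF min_risk_tendsto])
  then have "((\<lambda>\<sigma>w. 1 / (1 - min_risk (v \<sigma>w) / \<delta>)) \<longlongrightarrow> 1 / (1 - M1 signal_prob / \<delta>)) (at_right 0)"
    using c assms(1) by (intro tendsto_intros) (auto simp: c_def)
  moreover have "\<forall>\<^sub>F \<sigma>w in at_right 0. 1 / (1 - min_risk (v \<sigma>w) / \<delta>) = (1 / v \<sigma>w)\<^sup>2 / \<sigma>w\<^sup>2"
    using pos by eventually_elim (simp add: power_divide mult.commute flip: sol)
  ultimately show ?thesis
    by (rule Lim_transform_eventually)
qed

end

theorem theorem7:
  fixes M :: "'a measure" and X Z :: "'a \<Rightarrow> real" and \<delta> \<epsilon> :: real
  assumes "prob_space M"
    and "X \<in> borel_measurable M"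
    and "integrable M (\<lambda>\<omega>. (X \<omega>)\<^sup>2)"
    and "distributed M lborel Z (\<lambda>z. ennreal (std_normal_density z))"
    and "prob_space.indep_var M borel X borel Z"
    and "0 < \<delta>" and "\<delta> < 1"
    and "measure M {\<omega> \<in> space M. X \<omega> \<noteq> 0} = \<epsilon>"
    and "M1 \<epsilon> < \<delta>"
  shows "\<exists>\<sigma>l :: real \<Rightarrow> real.
      (\<forall>\<sigma>w>0. stable_fixed_point (Psi M X Z \<delta> \<sigma>w) (\<sigma>l \<sigma>w) \<and>
         (\<forall>\<sigma>. fixed_point (Psi M X Z \<delta> \<sigma>w) \<sigma> \<longrightarrow> \<sigma> = \<sigma>l \<sigma>w)) \<and>
      ((\<lambda>\<sigma>w. (\<sigma>l \<sigma>w)\<^sup>2 / \<sigma>w\<^sup>2) \<longlongrightarrow> 1 / (1 - M1 \<epsilon> / \<delta>)) (at_right 0)"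
proof -
  interpret soft_threshold_model M X Z
    using assms(1-5) by (simp add: soft_threshold_model_def soft_threshold_model_axioms_def)
  have \<epsilon>: "\<epsilon> = signal_prob"
    using assms(8) by (simp add: signal_prob_def)
  have "\<forall>\<sigma>w. \<exists>v. 0 < \<sigma>w \<longrightarrow> 0 < v \<and> level \<delta> \<sigma>w v = 1"
    using level_eq_1_ex assms(6,9) \<epsilon> by blast
  then obtain v where v: "\<And>\<sigma>w. 0 < \<sigma>w \<Longrightarrow> 0 < v \<sigma>w \<and> level \<delta> \<sigma>w (v \<sigma>w) = 1"
    by metis
  \<comment> \<open>Uniqueness among all fixed points, stable or not, by injectivity of
    \<open>level\<close> on \<open>v \<ge> 0\<close>.\<close>
  have "\<sigma> = 1 / v \<sigma>w" if "0 < \<sigma>w" and "fixed_point (Psi M X Z \<delta> \<sigma>w) \<sigma>" for \<sigma>w \<sigma>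
  proof -
    have "0 < \<sigma>" "level \<delta> \<sigma>w (1 / \<sigma>) = 1"
      using that assms(6) by (auto simp: fixed_point_iff_level)
    then have "1 / \<sigma> = v \<sigma>w"
      using v[OF that(1)] level_strict_mono[OF assms(6) that(1)]
      by (metis less_imp_le less_irrefl linorder_neqE_linordered_idom zero_less_divide_1_iff)
    then show ?thesis by (metis div_by_1 divide_divide_eq_right mult_1)
  qed
  then show ?thesis
    using v assms(6,9) \<epsilon> stable_fixed_point_of_level level_solution_ratio_tendsto[of \<delta> v]
    by (intro exI[of _ "\<lambda>\<sigma>w. 1 / v \<sigma>w"]) auto
qed

end
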